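(* Let $S$ be a closed orientable surface of genus $g\ge 2$ endowed with a length metric such that in any homotopy class of closed curves there is one with minimal length, and let $\mathbb{K}$ be a ring. Let $\gamma_1,\dots,\gamma_{2g}\in H_1(S;\mathbb{K})$ be obtained by successive minima procedure I. Then for any sequence of linearly independent $\delta_1,\dots,\delta_{2g}\in H_1(S;\mathbb{K})$ ordered by increasing length we have $$\ell(\gamma_k)\le\ell(\delta_k),\qquad k=1,\dots,2g.$$
   Context: $H_1(S;\mathbb{K})$ is the first homology group of $S$ with coefficients in $\mathbb{K}$; linear independence is over $\mathbb{K}$. The length of a curve is denoted by $\ell$, and homology classes are represented by closed curves of minimal length in their homology class, so that $\ell$ of a homology class is the length of such a representing curve. Ordered by increasing length means $\ell(\delta_1)\le\dots\le\ell(\delta_{2g})$. Successive minima procedure I for $H_1(S;\mathbb{K})$, producing curves $\alpha_1,\dots,\alpha_m$, is the following search: 1) take $\alpha_1$ to be a shortest homologically non-trivial curve; 2) for $j=2,\dots,m$, take $\alpha_j$ to be a shortest curve whose homology class $[\alpha_j]$ is not a linear combination over $\mathbb{K}$ of the homology classes of $\alpha_1,\dots,\alpha_{j-1}$. Here $m=2g$ and $\gamma_j=[\alpha_j]$ for $j=1,\dots,2g$. *)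

theory Defs
  imports "HOL-Analysis.Analysis" "HOL-Homology.Homology" "HOL-Algebra.Module"
begin

section \<open>Singular homology with coefficients in a ring\<close>

text \<open>The library fixes integer coefficients. The definitions below repeat it for an arbitrary
  associative unital (not necessarily commutative) ring, based on the library's singular simplices
  and faces. Homology is a left module over the coefficient ring.\<close>

type_synonym ('a, 'k) rchain = "((nat \<Rightarrow> real) \<Rightarrow> 'a) \<Rightarrow>\<^sub>0 'k"

definition rchains :: "nat \<Rightarrow> 'a topology \<Rightarrow> ('a, 'k::ring_1) rchain set" where
  "rchains p X = {c. Poly_Mapping.keys c \<subseteq> singular_simplex_set p X}"

definition rboundary :: "nat \<Rightarrow> ('a, 'k::ring_1) rchain \<Rightarrow> ('a, 'k) rchain" where
  "rboundary p c =
     (if p = 0 then 0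
      else \<Sum>f\<in>Poly_Mapping.keys c. \<Sum>k\<le>p.
             Poly_Mapping.single (singular_face p k f) ((-1) ^ k * Poly_Mapping.lookup c f))"

definition rcycles :: "nat \<Rightarrow> 'a topology \<Rightarrow> ('a, 'k::ring_1) rchain set" where
  "rcycles p X = {c \<in> rchains p X. rboundary p c = 0}"

definition rboundaries :: "nat \<Rightarrow> 'a topology \<Rightarrow> ('a, 'k::ring_1) rchain set" where
  "rboundaries p X = rboundary (Suc p) ` rchains (Suc p) X"

definition rclass :: "nat \<Rightarrow> 'a topology \<Rightarrow> ('a, 'k::ring_1) rchain \<Rightarrow> ('a, 'k) rchain set" where
  "rclass p X z = {z'. z' - z \<in> rboundaries p X}"

text \<open>The quotient of cycles by boundaries. The record is used only for its additive part and scalar multiplication;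
  the multiplicative fields are junk.\<close>

definition rhomology :: "nat \<Rightarrow> 'a topology \<Rightarrow> ('k::ring_1, ('a, 'k) rchain set) module" where
  "rhomology p X =
     \<lparr> carrier = rclass p X ` rcycles p X,
       mult = undefined, one = undefined,
       zero = rclass p X 0,
       add = (\<lambda>A B. \<Union>a\<in>A. \<Union>b\<in>B. rclass p X (a + b)),
       smult = (\<lambda>r A. \<Union>a\<in>A. rclass p X (Poly_Mapping.map ((*) r) a)) \<rparr>"

text \<open>Left-linear combinations and independence; coefficients range over the whole type
  \<open>'k\<close>, so the coefficient ring is not part of the module record.\<close>

definition linear_combination_of ::
    "('k::ring_1, 'b) module \<Rightarrow> 'i set \<Rightarrow> ('i \<Rightarrow> 'b) \<Rightarrow> 'b \<Rightarrow> bool" where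
  "linear_combination_of M I v x \<longleftrightarrow>
     (\<exists>c::'i \<Rightarrow> 'k. x = (\<Oplus>\<^bsub>M\<^esub>i\<in>I. c i \<odot>\<^bsub>M\<^esub> v i))"

definition linearly_independent ::
    "('k::ring_1, 'b) module \<Rightarrow> 'i set \<Rightarrow> ('i \<Rightarrow> 'b) \<Rightarrow> bool" where
  "linearly_independent M I v \<longleftrightarrow>
     (\<forall>c::'i \<Rightarrow> 'k. (\<Oplus>\<^bsub>M\<^esub>i\<in>I. c i \<odot>\<^bsub>M\<^esub> v i) = \<zero>\<^bsub>M\<^esub> \<longrightarrow> (\<forall>i\<in>I. c i = 0))"


section \<open>Closed curves and their homology classes\<close>

definition closed_curve :: "'a topology \<Rightarrow> (real \<Rightarrow> 'a) \<Rightarrow> bool" where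
  "closed_curve X c \<longleftrightarrow> pathin X c \<and> c 0 = c 1"

text \<open>Free homotopy; the counterpart of \<open>homotopic_loops\<close> for abstract topologies.\<close>

definition freely_homotopic :: "'a topology \<Rightarrow> (real \<Rightarrow> 'a) \<Rightarrow> (real \<Rightarrow> 'a) \<Rightarrow> bool" where
  "freely_homotopic X c c' \<longleftrightarrow>
     homotopic_with (\<lambda>h. h 0 = h 1) (top_of_set {0..1::real}) X c c'"

text \<open>The segment from vertex 0 to vertex 1 of the standard 1-simplex is parametrised by the
  barycentric coordinate of vertex 1.\<close>

definition curve_simplex :: "(real \<Rightarrow> 'a) \<Rightarrow> (nat \<Rightarrow> real) \<Rightarrow> 'a" where
  "curve_simplex c = restrict (\<lambda>x. c (x 1)) (standard_simplex 1)"

definition curve_class :: "'a topology \<Rightarrow> (real \<Rightarrow> 'a) \<Rightarrow> ('a, 'k::ring_1) rchain set" where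
  "curve_class X c = rclass 1 X (Poly_Mapping.single (curve_simplex c) 1)"


section \<open>Length metrics\<close>

definition curve_length :: "('a \<Rightarrow> 'a \<Rightarrow> real) \<Rightarrow> (real \<Rightarrow> 'a) \<Rightarrow> ennreal" where
  "curve_length d c =
     (SUP (n, t) \<in> {(n::nat, t::nat \<Rightarrow> real). mono_on {..n} t \<and> t ` {..n} \<subseteq> {0..1}}.
        \<Sum>i<n. ennreal (d (c (t i)) (c (t (Suc i)))))"

definition length_metric :: "'a set \<Rightarrow> ('a \<Rightarrow> 'a \<Rightarrow> real) \<Rightarrow> bool" where
  "length_metric S d \<longleftrightarrow>
     Metric_space S d \<and>
     (\<forall>x\<in>S. \<forall>y\<in>S. ennreal (d x y) =
        (INF c \<in> {c. pathin (Metric_space.mtopology S d) c \<and> c 0 = x \<and> c 1 = y}. curve_length d c))"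

definition has_minimal_closed_curves :: "'a topology \<Rightarrow> ('a \<Rightarrow> 'a \<Rightarrow> real) \<Rightarrow> bool" where
  "has_minimal_closed_curves X d \<longleftrightarrow>
     (\<forall>c. closed_curve X c \<longrightarrow>
        (\<exists>c'. freely_homotopic X c c' \<and>
              (\<forall>c''. freely_homotopic X c c'' \<longrightarrow> curve_length d c' \<le> curve_length d c'')))"

text \<open>The length of a homology class is the minimal length of a closed curve representing it. As
  the infimum of the empty set is \<open>\<infinity>\<close>, a class represented by no closed curve (these exist e.g. for
  real coefficients) has infinite length.\<close>

definition class_length ::
    "'a topology \<Rightarrow> ('a \<Rightarrow> 'a \<Rightarrow> real) \<Rightarrow> ('a, 'k::ring_1) rchain set \<Rightarrow> ennreal" where
  "class_length X d h = (INF c \<in> {c. closed_curve X c \<and> curve_class X c = h}. curve_length d c)"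


section \<open>Closed orientable surfaces\<close>

text \<open>The closed orientable surface of genus \<open>g \<ge> 1\<close> is the \<open>4g\<close>-gon with sides identified in pairs
  according to the boundary word \<open>a\<^sub>1 b\<^sub>1 a\<^sub>1\<inverse> b\<^sub>1\<inverse> \<dots> a\<^sub>g b\<^sub>g a\<^sub>g\<inverse> b\<^sub>g\<inverse>\<close>. The polygon is modelled by the closed
  unit disc, its boundary divided into \<open>4g\<close> arcs; arc \<open>k\<close> runs from \<open>polygon_point g k\<close> to
  \<open>polygon_point g (k + 1)\<close>.\<close>

definition polygon_point :: "nat \<Rightarrow> real \<Rightarrow> complex" where
  "polygon_point g s = cis (2 * pi * s / (4 * real g))"

definition side_pairing :: "nat \<Rightarrow> complex \<Rightarrow> complex \<Rightarrow> bool" where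
  "side_pairing g z w \<longleftrightarrow>
     (\<exists>j<g. \<exists>t\<in>{0..1}.
        z = polygon_point g (4 * real j + t) \<and> w = polygon_point g (4 * real j + 3 - t) \<or>
        z = polygon_point g (4 * real j + 1 + t) \<and> w = polygon_point g (4 * real j + 4 - t))"

definition closed_orientable_surface :: "nat \<Rightarrow> 'a topology \<Rightarrow> bool" where
  "closed_orientable_surface g X \<longleftrightarrow>
     (\<exists>q. quotient_map (top_of_set (cball (0::complex) 1)) X q \<and>
          (\<forall>z\<in>cball 0 1. \<forall>w\<in>cball 0 1. q z = q w \<longleftrightarrow> equivclp (side_pairing g) z w))"


section \<open>Successive minima\<close>

definition shortest_closed_curve ::
    "'a topology \<Rightarrow> ('a \<Rightarrow> 'a \<Rightarrow> real) \<Rightarrow> ((real \<Rightarrow> 'a) \<Rightarrow> bool) \<Rightarrow> (real \<Rightarrow> 'a) \<Rightarrow> bool" where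
  "shortest_closed_curve X d P c \<longleftrightarrow>
     closed_curve X c \<and> P c \<and>
     (\<forall>c'. closed_curve X c' \<and> P c' \<longrightarrow> curve_length d c \<le> curve_length d c')"

text \<open>The coefficient ring is not determined by the curves, hence the type argument.\<close>

definition successive_minima_I ::
    "'k::ring_1 itself \<Rightarrow> 'a topology \<Rightarrow> ('a \<Rightarrow> 'a \<Rightarrow> real) \<Rightarrow> nat \<Rightarrow> (nat \<Rightarrow> real \<Rightarrow> 'a) \<Rightarrow> bool" where
  "successive_minima_I K X d m \<alpha> \<longleftrightarrow>
     (let H = (rhomology 1 X :: ('k, ('a, 'k) rchain set) module) in
      shortest_closed_curve X d (\<lambda>c. curve_class X c \<noteq> \<zero>\<^bsub>H\<^esub>) (\<alpha> 1) \<and>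
      (\<forall>j\<in>{2..m}. shortest_closed_curve X d
         (\<lambda>c. \<not> linear_combination_of H {1..j - 1} (\<lambda>i. curve_class X (\<alpha> i)) (curve_class X c)) (\<alpha> j)))"

end

theory Submission
  imports Defs
begin

text \<open>If \<open>\<ell>(\<delta>\<^sub>k) < \<ell>(\<gamma>\<^sub>k)\<close>, then \<open>\<delta>\<^sub>1, \<dots>, \<delta>\<^sub>k\<close> are represented by curves shorter than \<open>\<alpha>\<^sub>k\<close>, so by
  minimality all of them are combinations of \<open>\<gamma>\<^sub>1, \<dots>, \<gamma>\<^sub>k\<^sub>-\<^sub>1\<close>. Over a general ring \<open>K\<close> this does not by
  itself contradict independence, since \<open>K\<close> may contain free modules of rank greater than 1. But
  classes of curves are integral: an additive map that retracts the finitely many elements of \<open>K\<close>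
  involved onto integers, up to a factor \<open>N\<close>, commutes with boundaries and turns the relations
  \<open>\<delta>\<^sub>i = \<Sum> c\<^sub>i\<^sub>j \<gamma>\<^sub>j\<close> into \<open>N \<delta>\<^sub>i = \<Sum> m\<^sub>i\<^sub>j \<gamma>\<^sub>j\<close> with an integer matrix \<open>m\<close> of \<open>k\<close> rows and \<open>k - 1\<close>
  columns. A primitive integer vector \<open>a\<close> in its left kernel yields \<open>\<Sum> N a\<^sub>i \<delta>\<^sub>i = 0\<close>, and primitivity
  prevents all \<open>a\<^sub>i\<close> from vanishing in \<open>K\<close>.\<close>

section \<open>Integral retractions and integer kernels\<close>

text \<open>The least positive element divides every other one, since the remainder of a division by
  it lies in \<open>H\<close> again. It serves below to describe which multiples of a given element
  lie in the domain of a relation.\<close>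

lemma int_subgroup_principal:
  fixes H :: "int set"
  assumes "0 \<in> H" and diff: "\<And>x y. x \<in> H \<Longrightarrow> y \<in> H \<Longrightarrow> x - y \<in> H"
  shows "\<exists>m\<in>H. \<forall>x\<in>H. m dvd x"
proof (cases "\<exists>n>0. int n \<in> H")
  case True
  define n where "n = (LEAST n. 0 < n \<and> int n \<in> H)"
  have n: "0 < n" "int n \<in> H"
    using LeastI_ex[OF True] by (auto simp: n_def)
  have least: "n \<le> k" if "0 < k" "int k \<in> H" for k
    unfolding n_def by (rule Least_le) (use that in auto)
  have add: "x + y \<in> H" if "x \<in> H" "y \<in> H" for x y
    using diff[OF that(1) diff[OF assms(1) that(2)]] by simp
  have mult_nat: "int k * int n \<in> H" for k
    by (induction k) (use add n assms(1) in \<open>auto simp: algebra_simps\<close>)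
  have mult: "k * int n \<in> H" for k
  proof (cases "k \<ge> 0")
    case True
    then show ?thesis using mult_nat[of "nat k"] by simp
  next
    case False
    then show ?thesis using diff[OF assms(1) mult_nat[of "nat (- k)"]] by simp
  qed
  have "int n dvd x" if "x \<in> H" for x
  proof (rule ccontr)
    assume "\<not> int n dvd x"
    then have "0 < x mod int n"
      using n pos_mod_sign[of "int n" x] by (metis dvd_eq_mod_eq_0 of_nat_0_less_iff order_less_le)
    moreover have "x mod int n \<in> H"
      using diff[OF that mult[of "x div int n"]] by (simp add: minus_div_mult_eq_mod)
    ultimately have "n \<le> nat (x mod int n)"
      by (intro least) auto
    then show False
      using n pos_mod_bound[of "int n" x] by linarith
  qed
  then show ?thesis using n by blast
next
  case False
  have "x = 0" if "x \<in> H" for x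
  proof (rule ccontr)
    assume "x \<noteq> 0"
    then consider "x > 0" | "0 - x > 0" by linarith
    then show False
      using False that diff[OF assms(1) that] by cases (metis zero_less_imp_eq_int)+
  qed
  then show ?thesis using assms(1) by auto
qed

text \<open>Injectivity of the divisible group \<open>\<rat> / G\<close>: a maximal additive relation whose fibre over
  \<open>0\<close> is contained in \<open>G\<close> is total, because a value at \<open>x\<close> is obtained by dividing a value at a
  multiple of \<open>x\<close>.\<close>

lemma additive_extension_modulo:
  fixes u :: "'a::ring_1" and q :: rat and G :: "rat set"
  assumes G: "0 \<in> G" "\<And>s t. s \<in> G \<Longrightarrow> t \<in> G \<Longrightarrow> s - t \<in> G"
    and u: "\<And>m. of_int m * u = 0 \<Longrightarrow> of_int m * q \<in> G"
  shows "\<exists>\<pi>::'a \<Rightarrow> rat. (\<forall>x y. \<pi> (x + y) - \<pi> x - \<pi> y \<in> G) \<and> \<pi> u - q \<in> G"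
proof -
  \<comment> \<open>The candidates for Zorn's lemma are the subgroups of the product that contain
    \<open>(u, q)\<close> and whose fibre over 0 lies in \<open>G\<close>; each is the graph of a
    partial homomorphism to the rationals modulo \<open>G\<close>.\<close>
  define \<R> :: "('a \<times> rat) set set" where
    "\<R> = {R. (u, q) \<in> R \<and> (\<forall>a\<in>R. \<forall>b\<in>R. a - b \<in> R) \<and> (\<forall>t. (0, t) \<in> R \<longrightarrow> t \<in> G)}"
  \<comment> \<open>The subgroup generated by \<open>(u, q)\<close> is a candidate, and the
    hypothesis on \<open>u\<close> is exactly its fibre condition.\<close>
  have "range (\<lambda>m. (of_int m * u, of_int m * q)) \<in> \<R>" (is "?R0 \<in> _")
  proof -
    have "a - b \<in> ?R0" if ab: "a \<in> ?R0" "b \<in> ?R0" for a b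
    proof -
      obtain m m' :: int
        where "a = (of_int m * u, of_int m * q)" "b = (of_int m' * u, of_int m' * q)"
        using ab by blast
      then have "a - b = (of_int (m - m') * u, of_int (m - m') * q)"
        by (simp add: left_diff_distrib)
      then show ?thesis by blast
    qed
    moreover have "(u, q) \<in> ?R0" by (rule range_eqI[of _ _ 1]) simp
    moreover have "t \<in> G" if t: "(0, t) \<in> ?R0" for t
    proof -
      obtain m where "0 = of_int m * u" "t = of_int m * q" using t by blast
      then show ?thesis using u by simp
    qed
    ultimately show ?thesis unfolding \<R>_def by blast
  qed
  moreover have "\<Union>\<C> \<in> \<R>" if ne: "\<C> \<noteq> {}" and ch: "subset.chain \<R> \<C>" for \<C>
  proof -
    have sub: "\<C> \<subseteq> \<R>" using ch by (simp add: subset_chain_def)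
    have "a - b \<in> \<Union>\<C>" if ab: "a \<in> \<Union>\<C>" "b \<in> \<Union>\<C>" for a b
    proof -
      obtain A B where AB: "A \<in> \<C>" "a \<in> A" "B \<in> \<C>" "b \<in> B" using ab by blast
      obtain C where "C \<in> \<C>" "a \<in> C" "b \<in> C"
        using AB ch unfolding subset_chain_def by blast
      then show ?thesis using sub unfolding \<R>_def by blast
    qed
    then show ?thesis using ne sub unfolding \<R>_def by blast
  qed
  ultimately obtain R where "R \<in> \<R>" and max: "\<And>R'. R' \<in> \<R> \<Longrightarrow> R \<subseteq> R' \<Longrightarrow> R' = R"
    using subset_Zorn_nonempty[of \<R>] by blast
  then have R: "(u, q) \<in> R" "\<And>a b. a \<in> R \<Longrightarrow> b \<in> R \<Longrightarrow> a - b \<in> R" "\<And>t. (0, t) \<in> R \<Longrightarrow> t \<in> G"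
    unfolding \<R>_def by blast+
  have R0: "0 \<in> R" using R(2)[OF R(1) R(1)] by (simp add: zero_prod_def)
  have Radd: "a + b \<in> R" if "a \<in> R" "b \<in> R" for a b
    using R(2)[OF that(1) R(2)[OF R0 that(2)]] by simp
  have mult_nat: "(of_nat k * x, of_nat k * r) \<in> R" if "(x, r) \<in> R" for k x r
  proof (induction k)
    case 0
    show ?case using R0 by (simp add: zero_prod_def)
  next
    case (Suc k)
    show ?case using Radd[OF that Suc] by (simp add: algebra_simps)
  qed
  have Rmult: "(of_int k * x, of_int k * r) \<in> R" if "(x, r) \<in> R" for k x r
  proof (cases "k \<ge> 0")
    case True
    then show ?thesis using mult_nat[OF that, of "nat k"] by simp
  next
    case False
    then show ?thesis
      using R(2)[OF R0 mult_nat[OF that, of "nat (- k)"]] by (simp add: zero_prod_def)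
  qed
  have total: "\<exists>r. (x, r) \<in> R" for x
  proof -
    \<comment> \<open>The integers \<open>m\<close> with \<open>m * x\<close> in the domain of
      \<open>R\<close> form a subgroup; a value at its generator dictates the value at
      \<open>x\<close>.\<close>
    define H where "H = {m::int. \<exists>s. (of_int m * x, s) \<in> R}"
    have "0 \<in> H" using R0 by (auto simp: H_def zero_prod_def)
    moreover have "m - m' \<in> H" if mm: "m \<in> H" "m' \<in> H" for m m'
    proof -
      obtain s s' where "(of_int m * x, s) \<in> R" "(of_int m' * x, s') \<in> R"
        using mm by (auto simp: H_def)
      then have "(of_int (m - m') * x, s - s') \<in> R"
        using R(2) by (fastforce simp: left_diff_distrib)
      then show ?thesis by (auto simp: H_def)
    qed
    ultimately obtain m where m: "m \<in> H" "\<And>n. n \<in> H \<Longrightarrow> m dvd n"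
      using int_subgroup_principal[of H] by blast
    then obtain s where s: "(of_int m * x, s) \<in> R" by (auto simp: H_def)
    \<comment> \<open>If \<open>m = 0\<close>, no nonzero multiple of \<open>x\<close> is in the
      domain and any value would do; division by zero then gives \<open>r = 0\<close>.\<close>
    define r where "r = s / of_int m"
    define R' where "R' = {a + (of_int n * x, of_int n * r) |a n. a \<in> R}"
    have R'I: "a + (of_int n * x, of_int n * r) \<in> R'" if "a \<in> R" for a n
      using that unfolding R'_def by blast
    have sub: "R \<subseteq> R'" using R'I[of _ 0] by (auto simp: zero_prod_def[symmetric])
    have "a - b \<in> R'" if ab: "a \<in> R'" "b \<in> R'" for a b
    proof -
      obtain a' n b' n' where
        "a = a' + (of_int n * x, of_int n * r)" "b = b' + (of_int n' * x, of_int n' * r)"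
        "a' \<in> R" "b' \<in> R"
        using ab by (auto simp: R'_def)
      moreover from this have "a - b = a' - b' + (of_int (n - n') * x, of_int (n - n') * r)"
        by (simp add: algebra_simps prod_eq_iff)
      ultimately show ?thesis
        using R'I[OF R(2)[of a' b'], of "n - n'"] by metis
    qed
    moreover have "t \<in> G" if t: "(0, t) \<in> R'" for t
    proof -
      obtain y v n where yv: "(y, v) \<in> R" "0 = y + of_int n * x" "t = v + of_int n * r"
        using t by (auto simp: R'_def)
      have y: "y = - (of_int n * x)" using yv(2) by (simp add: eq_neg_iff_add_eq_0)
      \<comment> \<open>\<open>R\<close> relates \<open>n * x\<close> both to \<open>- v\<close> and
        to \<open>j * s\<close>, so these two values differ by an element of \<open>G\<close>. For
        \<open>m \<noteq> 0\<close> the latter equals \<open>n * r\<close>; for \<open>m = 0\<close>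
        also \<open>n = 0\<close> and \<open>y = 0\<close>, whence \<open>t = v\<close>.\<close>
      have nx: "(of_int n * x, - v) \<in> R"
        using R(2)[OF R0 yv(1)] y by (simp add: zero_prod_def)
      then obtain j where j: "n = m * j" using m(2) by (auto simp: H_def)
      have jm: "(of_int n * x, of_int j * s) \<in> R"
        using Rmult[OF s, of j] j by (simp add: mult.commute[of m j] mult.assoc)
      have "of_int j * s - (- v) \<in> G"
        using R(2)[OF jm nx] R(3) by simp
      moreover have "of_int n * r - of_int j * s = 0" if "m \<noteq> 0"
        using that by (simp add: r_def j)
      moreover have ?thesis if "m = 0"
        using yv that j R(3) by simp
      ultimately show ?thesis using yv(3) by (cases "m = 0") (auto simp: algebra_simps)
    qed
    ultimately have "R' \<in> \<R>" using sub R(1) unfolding \<R>_def by blast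
    then have "R' = R" using max sub by blast
    then show ?thesis using R'I[OF R0, of 1] by auto
  qed
  \<comment> \<open>\<open>R\<close> may relate \<open>x\<close> to several values, but they agree
    modulo \<open>G\<close>. Hence any choice is additive modulo \<open>G\<close>.\<close>
  define \<pi> where "\<pi> x = (SOME r. (x, r) \<in> R)" for x
  have \<pi>: "(x, \<pi> x) \<in> R" for x
    unfolding \<pi>_def using total by (rule someI_ex)
  have "\<pi> (x + y) - \<pi> x - \<pi> y \<in> G" for x y
    using R(2)[OF R(2)[OF \<pi>[of "x + y"] \<pi>[of x]] \<pi>[of y]] R(3) by simp
  moreover have "\<pi> u - q \<in> G"
    using R(2)[OF \<pi>[of u] R(1)] R(3) by simp
  ultimately show ?thesis by blast
qed

lemma rat_common_denominator:
  assumes "finite (F :: rat set)"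
  shows "\<exists>N::int. N \<noteq> 0 \<and> (\<forall>x\<in>F. of_int N * x \<in> \<int>)"
  using assms
proof (induction F)
  case empty
  show ?case by (rule exI[of _ 1]) simp
next
  case (insert x F)
  then obtain N where N: "N \<noteq> 0" "\<forall>x\<in>F. of_int N * x \<in> \<int>" by blast
  obtain a b where x: "x = of_int a / of_int b" "b > 0"
    by (metis quotient_of_div quotient_of_denom_pos surj_pair)
  have "of_int (N * b) * y \<in> \<int>" if "y \<in> insert x F" for y
  proof (cases "y = x")
    case True
    then have "of_int (N * b) * y = of_int (N * a)" using x by simp
    then show ?thesis by (metis Ints_of_int)
  next
    case False
    then have "of_int N * y \<in> \<int>" using that N by blast
    then have "of_int b * (of_int N * y) \<in> \<int>" by (rule Ints_mult[OF Ints_of_int])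
    then show ?thesis by (simp add: mult_ac)
  qed
  then show ?case using N x by (intro exI[of _ "N * b"]) auto
qed

text \<open>Closure under differences makes \<open>A\<close> a subgroup and \<open>f\<close> a
  homomorphism on it. Outside \<open>A\<close> the values of \<open>f\<close> are arbitrary, which
  allows for a retraction that is additive only where denominators have been cleared.\<close>

definition additive_on :: "'a::ab_group_add set \<Rightarrow> ('a \<Rightarrow> 'b::ab_group_add) \<Rightarrow> bool" where
  "additive_on A f \<longleftrightarrow> 0 \<in> A \<and> (\<forall>x\<in>A. \<forall>y\<in>A. x - y \<in> A \<and> f (x - y) = f x - f y)"

text \<open>A finitely generated additive subgroup of a ring retracts, up to a multiple \<open>N\<close>, onto the
  integral multiples of 1: in characteristic 0 one extends \<open>\<int> \<rightarrow> \<rat>\<close> and clears denominators, in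
  characteristic \<open>n > 0\<close> one extends \<open>\<int>/n \<rightarrow> \<rat>/\<int>\<close>, whose \<open>n\<close>-torsion is \<open>\<int>/n\<close>.\<close>

lemma integral_retraction:
  fixes F :: "'k::ring_1 set"
  assumes "finite F"
  obtains A and f :: "'k \<Rightarrow> 'k" and N :: int
  where "F \<subseteq> A" "1 \<in> A" "additive_on A f" "range f \<subseteq> \<int>" "f 1 = of_int N"
    "\<And>m. (of_int (N * m) :: 'k) = 0 \<Longrightarrow> (of_int m :: 'k) = 0"
proof -
  define n where "n = int CHAR('k)"
  \<comment> \<open>The target modulo \<open>G\<close> is the rationals in characteristic 0 and the
    rationals modulo the integers otherwise; \<open>q\<close>, the intended image of 1, has the same
    additive order there as 1 has in the ring.\<close>
  define G :: "rat set" where "G = (if n = 0 then {0} else \<int>)"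
  define q :: rat where "q = (if n = 0 then 1 else 1 / of_int n)"
  have G_iff: "x \<in> G \<longleftrightarrow> (if n = 0 then x = 0 else x \<in> \<int>)" for x
    by (simp add: G_def)
  have G0: "0 \<in> G" by (simp add: G_iff)
  have Gdiff: "s - t \<in> G" if "s \<in> G" "t \<in> G" for s t
    using that by (auto simp: G_iff split: if_splits)
  have char: "(of_int m :: 'k) = 0 \<longleftrightarrow> n dvd m" for m
    by (simp add: of_int_eq_0_iff_char_dvd n_def)
  have "of_int m * q \<in> G" if "of_int m * (1::'k) = 0" for m
    using that by (auto simp: char G_iff q_def elim!: dvdE)
  then obtain \<pi> :: "'k \<Rightarrow> rat" where
    add: "\<And>x y. \<pi> (x + y) - \<pi> x - \<pi> y \<in> G" and one: "\<pi> 1 - q \<in> G"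
    using additive_extension_modulo[OF G0 Gdiff, of "1::'k" q] by blast
  have add': "\<pi> (x - y) - (\<pi> x - \<pi> y) \<in> G" for x y
    using add[of "x - y" y] by (auto simp: G_iff algebra_simps split: if_splits dest: Ints_minus)
  have \<pi>_mult: "\<pi> (of_nat k * x) - of_nat k * \<pi> x \<in> \<int>" if "n \<noteq> 0" for k x
  proof (induction k)
    case 0
    show ?case using add[of 0 0] that Ints_minus by (fastforce simp: G_iff)
  next
    case (Suc k)
    have "\<pi> (x + of_nat k * x) - \<pi> x - \<pi> (of_nat k * x) + (\<pi> (of_nat k * x) - of_nat k * \<pi> x) \<in> \<int>"
      using add[of x "of_nat k * x"] Suc that by (intro Ints_add) (auto simp: G_iff)
    then show ?case by (simp add: algebra_simps)
  qed
  \<comment> \<open>In characteristic 0, \<open>D\<close> is a common denominator of the finitely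
    many values. In characteristic \<open>n > 0\<close>, \<open>D = n\<close> works for every
    \<open>x\<close>, because \<open>n * x = 0\<close> makes \<open>n * \<pi> x\<close> an
    integer.\<close>
  have "\<exists>D::int. (\<forall>x\<in>insert 1 F. of_int D * \<pi> x \<in> \<int>) \<and> D \<noteq> 0 \<and> (n \<noteq> 0 \<longrightarrow> D = n)"
  proof (cases "n = 0")
    case True
    then show ?thesis using rat_common_denominator[of "\<pi> ` insert 1 F"] assms by auto
  next
    case False
    have "of_int n * \<pi> x \<in> \<int>" for x
    proof -
      have "\<pi> (of_nat CHAR('k) * x) \<in> \<int>"
        using \<pi>_mult[OF False, of 0 x] by simp
      then have "\<pi> (of_nat CHAR('k) * x) - (\<pi> (of_nat CHAR('k) * x) - of_nat CHAR('k) * \<pi> x) \<in> \<int>"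
        using \<pi>_mult[OF False, of "CHAR('k)" x] by (rule Ints_diff)
      then show ?thesis by (simp add: n_def)
    qed
    then show ?thesis using False by blast
  qed
  then obtain D :: int where D: "\<And>x. x \<in> insert 1 F \<Longrightarrow> of_int D * \<pi> x \<in> \<int>" "D \<noteq> 0" "n \<noteq> 0 \<Longrightarrow> D = n"
    by blast
  define A where "A = {x. of_int D * \<pi> x \<in> \<int>}"
  \<comment> \<open>On \<open>A\<close> the floor only converts an integral rational into an
    integer.\<close>
  define f :: "'k \<Rightarrow> 'k" where "f x = of_int \<lfloor>of_int D * \<pi> x\<rfloor>" for x
  \<comment> \<open>Multiplication by \<open>D\<close> turns the ambiguity in \<open>G\<close> into
    a multiple of \<open>n\<close>, which vanishes in the ring. So \<open>f\<close> is genuinely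
    additive on \<open>A\<close>.\<close>
  have DG: "\<exists>j. of_int D * t = of_int (n * j)" if "t \<in> G" for t
    using that D(3) by (cases "n = 0") (auto simp: G_iff elim!: Ints_cases)
  have "x - y \<in> A \<and> f (x - y) = f x - f y" if xy: "x \<in> A" "y \<in> A" for x y
  proof -
    obtain a b where ab: "of_int D * \<pi> x = of_int a" "of_int D * \<pi> y = of_int b"
      using xy by (auto simp: A_def elim!: Ints_cases)
    obtain j where "of_int D * (\<pi> (x - y) - (\<pi> x - \<pi> y)) = of_int (n * j)"
      using DG[OF add'] by blast
    then have "of_int D * \<pi> (x - y) = of_int (n * j) + (of_int D * \<pi> x - of_int D * \<pi> y)"
      by (simp add: algebra_simps)
    then have eq: "of_int D * \<pi> (x - y) = of_int (n * j + (a - b))"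
      by (simp add: ab)
    have "(of_int (n * j) :: 'k) = 0" by (subst char) simp
    then show ?thesis
      unfolding A_def f_def eq ab mem_Collect_eq floor_of_int
      by (metis Ints_of_int of_int_add of_int_diff add_0)
  qed
  moreover have one_A: "1 \<in> A" and "F \<subseteq> A" using D(1) by (auto simp: A_def)
  moreover have "0 \<in> A" using calculation(1)[OF one_A one_A] by simp
  moreover have "range f \<subseteq> \<int>" by (auto simp: f_def)
  \<comment> \<open>Here \<open>N = D\<close> in characteristic 0. In positive characteristic
    \<open>N = 1\<close>, since \<open>n * (1 / n) = 1\<close>.\<close>
  moreover have "\<exists>N. f 1 = of_int N \<and> (\<forall>m. (of_int (N * m) :: 'k) = 0 \<longrightarrow> (of_int m :: 'k) = 0)"
  proof (cases "n = 0")
    case True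
    then have "f 1 = of_int D" using one by (simp add: f_def G_iff q_def)
    moreover have "(of_int (D * m) :: 'k) = 0 \<longrightarrow> (of_int m :: 'k) = 0" for m
      unfolding char using True D(2) by simp
    ultimately show ?thesis by blast
  next
    case False
    obtain j where "of_int D * (\<pi> 1 - q) = of_int (n * j)" using DG[OF one] by blast
    then have eq: "of_int D * \<pi> 1 = of_int (n * j + 1)"
      using False D by (simp add: q_def algebra_simps)
    have "(of_int (n * j) :: 'k) = 0" by (subst char) simp
    then have "f 1 = of_int 1" unfolding f_def eq floor_of_int by (metis of_int_add add_0)
    then show ?thesis by (intro exI[of _ 1]) simp
  qed
  ultimately show ?thesis
    using that[of A f] unfolding additive_on_def by blast
qed

text \<open>Gaussian elimination without division.\<close>

lemma int_left_kernel_nontrivial: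
  fixes m :: "'i \<Rightarrow> 'j \<Rightarrow> int"
  assumes "finite J" "finite I" "card J < card I"
  shows "\<exists>a. (\<exists>i\<in>I. a i \<noteq> 0) \<and> (\<forall>j\<in>J. (\<Sum>i\<in>I. a i * m i j) = 0)"
  using assms
proof (induction J arbitrary: I m rule: finite_induct)
  case empty
  then have "I \<noteq> {}" by auto
  then show ?case by (intro exI[of _ "\<lambda>_. 1"]) auto
next
  case (insert j J)
  show ?case
  proof (cases "\<exists>l\<in>I. m l j \<noteq> 0")
    case False
    moreover obtain a where "\<exists>i\<in>I. a i \<noteq> 0" "\<forall>j\<in>J. (\<Sum>i\<in>I. a i * m i j) = 0"
      using insert.IH[of I m] insert.prems insert.hyps by auto
    ultimately show ?thesis by (intro exI[of _ a]) auto
  next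
    case True
    then obtain l where l: "l \<in> I" "m l j \<noteq> 0" by blast
    define I' where "I' = I - {l}"
    have I': "finite I'" "l \<notin> I'" "I = insert l I'" using l insert.prems by (auto simp: I'_def)
    then have "card J < card I'" using insert.prems insert.hyps by simp
    then obtain a where a: "\<exists>i\<in>I'. a i \<noteq> 0"
      "\<And>h. h \<in> J \<Longrightarrow> (\<Sum>i\<in>I'. a i * (m l j * m i h - m i j * m l h)) = 0"
      using insert.IH[of I' "\<lambda>i h. m l j * m i h - m i j * m l h"] I'(1) by blast
    \<comment> \<open>Multiplying the other rows by the pivot \<open>m l j\<close> avoids division;
      the entry at \<open>l\<close> is chosen to make column \<open>j\<close> cancel.\<close>
    define b where "b i = (if i = l then - (\<Sum>i\<in>I'. a i * m i j) else m l j * a i)" for i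
    have b: "(\<Sum>i\<in>I. b i * m i h) = (\<Sum>i\<in>I'. a i * (m l j * m i h - m i j * m l h))" for h
    proof -
      have "(\<Sum>i\<in>I. b i * m i h) = b l * m l h + (\<Sum>i\<in>I'. m l j * a i * m i h)"
        using I' by (auto simp: b_def intro!: sum.cong)
      then show ?thesis
        by (simp add: b_def algebra_simps sum_subtractf sum_distrib_left)
    qed
    have "(\<Sum>i\<in>I. b i * m i h) = 0" if "h \<in> insert j J" for h
      using that a(2) unfolding b by (cases "h = j") (auto simp: mult.commute)
    moreover have "\<exists>i\<in>I. b i \<noteq> 0" using a(1) l I' by (auto simp: b_def)
    ultimately show ?thesis by blast
  qed
qed

text \<open>A nonzero kernel vector stays in the kernel after division by the gcd of its entries, as
  a nonzero integer can be cancelled. Unlike a merely nonzero vector, a primitive one does not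
  vanish modulo any characteristic other than 1.\<close>

lemma int_left_kernel_primitive:
  fixes m :: "'i \<Rightarrow> 'j \<Rightarrow> int"
  assumes "finite J" "finite I" "card J < card I"
  obtains a where "Gcd (a ` I) = 1" "\<And>j. j \<in> J \<Longrightarrow> (\<Sum>i\<in>I. a i * m i j) = 0"
proof -
  obtain a where a: "\<exists>i\<in>I. a i \<noteq> 0" "\<And>j. j \<in> J \<Longrightarrow> (\<Sum>i\<in>I. a i * m i j) = 0"
    using int_left_kernel_nontrivial[OF assms, of m] by blast
  define d where "d = Gcd (a ` I)"
  define b where "b i = a i div d" for i
  have d: "d \<noteq> 0" using a(1) by (auto simp: d_def)
  have ab: "a i = d * b i" if "i \<in> I" for i
    using that by (simp add: b_def d_def Gcd_dvd)
  have "a ` I = (*) d ` b ` I" using ab by (auto simp: image_image)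
  then have "d = normalize (d * Gcd (b ` I))" by (metis d_def Gcd_mult)
  then have "Gcd (b ` I) = 1"
    using d by (simp add: abs_mult d_def)
  moreover have "(\<Sum>i\<in>I. b i * m i j) = 0" if "j \<in> J" for j
  proof -
    have "d * (\<Sum>i\<in>I. b i * m i j) = 0"
      using a(2)[OF that] by (simp add: sum_distrib_left ab mult.assoc cong: sum.cong)
    then show ?thesis using d by simp
  qed
  ultimately show ?thesis using that by blast
qed

section \<open>Additive maps of coefficients\<close>

lemma additive_on_zero: "additive_on A f \<Longrightarrow> f 0 = 0"
  unfolding additive_on_def by (metis diff_self)

lemma additive_on_diff:
  assumes "additive_on A f" "x \<in> A" "y \<in> A"
  shows "x - y \<in> A" "f (x - y) = f x - f y"
  using assms unfolding additive_on_def by blast+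

lemma additive_on_minus:
  assumes "additive_on A f" "x \<in> A"
  shows "- x \<in> A" "f (- x) = - f x"
  using additive_on_diff[OF assms(1), of 0 x] assms additive_on_zero[OF assms(1)]
  by (simp_all add: additive_on_def)

lemma additive_on_add:
  assumes "additive_on A f" "x \<in> A" "y \<in> A"
  shows "x + y \<in> A" "f (x + y) = f x + f y"
  using additive_on_diff[OF assms(1,2) additive_on_minus(1)[OF assms(1,3)]]
    additive_on_minus(2)[OF assms(1,3)] by simp_all

lemma additive_on_sum:
  assumes "additive_on A f" "\<And>i. i \<in> I \<Longrightarrow> h i \<in> A"
  shows "sum h I \<in> A" "f (sum h I) = (\<Sum>i\<in>I. f (h i))"
proof -
  have "sum h I \<in> A \<and> f (sum h I) = (\<Sum>i\<in>I. f (h i))"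
    using assms(2)
  proof (induction I rule: infinite_finite_induct)
    case (insert x I)
    then show ?case using additive_on_add[OF assms(1)] by simp
  qed (use assms(1) additive_on_zero[OF assms(1)] in \<open>auto simp: additive_on_def\<close>)
  then show "sum h I \<in> A" "f (sum h I) = (\<Sum>i\<in>I. f (h i))" by blast+
qed

lemma additive_on_sign:
  fixes f :: "'a::ring_1 \<Rightarrow> 'b::ring_1"
  assumes "additive_on A f" "x \<in> A"
  shows "(-1) ^ n * x \<in> A" "f ((-1) ^ n * x) = (-1) ^ n * f x"
  using assms additive_on_minus[OF assms] by (cases "even n"; simp)+

lemma additive_on_mult_left: "additive_on UNIV ((*) (r::'k::ring_1))"
  by (simp add: additive_on_def right_diff_distrib)

lemma lookup_map_zero:
  "f 0 = 0 \<Longrightarrow> Poly_Mapping.lookup (Poly_Mapping.map f c) s = f (Poly_Mapping.lookup c s)"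
  by (simp add: Poly_Mapping.map.rep_eq when_def)

lemma keys_map_zero:
  "f 0 = 0 \<Longrightarrow> Poly_Mapping.keys (Poly_Mapping.map f c) \<subseteq> Poly_Mapping.keys c"
  by (metis in_keys_iff lookup_map_zero subsetI)

lemma map_single_zero:
  "f 0 = 0 \<Longrightarrow> Poly_Mapping.map f (Poly_Mapping.single s x) = Poly_Mapping.single s (f x)"
  by (rule poly_mapping_eqI) (auto simp: lookup_map_zero lookup_single when_def)

lemma single_sum: "Poly_Mapping.single s (\<Sum>i\<in>I. x i) = (\<Sum>i\<in>I. Poly_Mapping.single s (x i))"
  by (induction I rule: infinite_finite_induct) (simp_all add: single_add)

section \<open>Chains and homology with coefficients\<close>

text \<open>Chains with different supports can thus be expanded over one common finite set.\<close>

lemma rboundary_superset: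
  assumes "finite T" "Poly_Mapping.keys c \<subseteq> T"
  shows "rboundary p c =
    (if p = 0 then 0
     else \<Sum>s\<in>T. \<Sum>k\<le>p. Poly_Mapping.single (singular_face p k s) ((-1) ^ k * Poly_Mapping.lookup c s))"
proof -
  have "(\<Sum>s\<in>Poly_Mapping.keys c. \<Sum>k\<le>p.
        Poly_Mapping.single (singular_face p k s) ((-1) ^ k * Poly_Mapping.lookup c s)) =
    (\<Sum>s\<in>T. \<Sum>k\<le>p. Poly_Mapping.single (singular_face p k s) ((-1) ^ k * Poly_Mapping.lookup c s))"
    using assms by (rule sum.mono_neutral_left) (simp add: in_keys_iff)
  then show ?thesis by (simp add: rboundary_def)
qed

lemma rboundary_diff: "rboundary p (c - d) = rboundary p c - rboundary p d"
proof -
  define T where "T = Poly_Mapping.keys c \<union> Poly_Mapping.keys d"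
  have T: "finite T" "Poly_Mapping.keys c \<subseteq> T" "Poly_Mapping.keys d \<subseteq> T"
    "Poly_Mapping.keys (c - d) \<subseteq> T"
    using keys_diff[of c d] by (auto simp: T_def)
  show ?thesis
    unfolding rboundary_superset[OF T(1,2)] rboundary_superset[OF T(1,3)] rboundary_superset[OF T(1,4)]
    by (simp add: lookup_minus right_diff_distrib single_diff sum_subtractf)
qed

text \<open>The boundary combines coefficients only by sums and signs, which an additive map
  respects. This applies to the integral retraction as well as to left multiplication by a
  scalar.\<close>

lemma rboundary_map:
  fixes f :: "'k::ring_1 \<Rightarrow> 'l::ring_1"
  assumes f: "additive_on A f" and c: "\<And>s. Poly_Mapping.lookup c s \<in> A"
  shows "rboundary p (Poly_Mapping.map f c) = Poly_Mapping.map f (rboundary p c)"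
proof (cases "p = 0")
  case True
  show ?thesis
    using True by (intro poly_mapping_eqI)
      (simp add: rboundary_def lookup_map_zero[where f = f] additive_on_zero[OF f])
next
  case False
  note f0 = additive_on_zero[OF f]
  have sub: "Poly_Mapping.keys (Poly_Mapping.map f c) \<subseteq> Poly_Mapping.keys c"
    by (rule keys_map_zero[where f = f, OF f0])
  have A: "((-1) ^ k * Poly_Mapping.lookup c s when P) \<in> A" for k s P
    using f additive_on_sign(1)[OF f c] by (simp add: when_def additive_on_def)
  have fA: "f ((-1) ^ k * Poly_Mapping.lookup c s when P) = ((-1) ^ k * f (Poly_Mapping.lookup c s) when P)" for k s P
    using additive_on_sign(2)[OF f c] f0 by (simp add: when_def)
  have sum: "f (\<Sum>k\<le>p. ((-1) ^ k * Poly_Mapping.lookup c s when P k s)) =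
      (\<Sum>k\<le>p. f ((-1) ^ k * Poly_Mapping.lookup c s when P k s))"
    "(\<Sum>k\<le>p. ((-1) ^ k * Poly_Mapping.lookup c s when P k s)) \<in> A" for P s
    by (rule additive_on_sum[OF f A])+
  have sum2: "f (\<Sum>s\<in>T. \<Sum>k\<le>p. ((-1) ^ k * Poly_Mapping.lookup c s when P k s)) =
      (\<Sum>s\<in>T. \<Sum>k\<le>p. f ((-1) ^ k * Poly_Mapping.lookup c s when P k s))" for P T
    unfolding sum(1)[symmetric] by (rule additive_on_sum(2)[OF f sum(2)])
  show ?thesis
    unfolding rboundary_superset[OF finite_keys sub]
      rboundary_superset[OF finite_keys subset_refl[of "Poly_Mapping.keys c"]]
    using False by (intro poly_mapping_eqI)
      (simp add: lookup_map_zero[where f = f] f0 lookup_sum lookup_single sum2 fA)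
qed

lemma rboundary_zero: "rboundary p 0 = 0"
  by (simp add: rboundary_def)

lemma rchains_zero: "0 \<in> rchains p X"
  by (simp add: rchains_def)

lemma rchains_diff: "c \<in> rchains p X \<Longrightarrow> d \<in> rchains p X \<Longrightarrow> c - d \<in> rchains p X"
  unfolding rchains_def using keys_diff[of c d] by blast

lemma rchains_map:
  assumes "f 0 = 0" "c \<in> rchains p X"
  shows "Poly_Mapping.map f c \<in> rchains p X"
  using keys_map_zero[where f = f, OF assms(1), of c] assms(2) unfolding rchains_def by blast

lemma rboundaries_zero: "0 \<in> rboundaries p X"
  unfolding rboundaries_def by (rule image_eqI[OF _ rchains_zero]) (simp add: rboundary_zero)

lemma rboundaries_diff:
  assumes "z \<in> rboundaries p X" "w \<in> rboundaries p X"
  shows "z - w \<in> rboundaries p X"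
proof -
  obtain b c where "z = rboundary (Suc p) b" "w = rboundary (Suc p) c"
    "b \<in> rchains (Suc p) X" "c \<in> rchains (Suc p) X"
    using assms unfolding rboundaries_def by blast
  then have "z - w = rboundary (Suc p) (b - c)" "b - c \<in> rchains (Suc p) X"
    by (simp_all add: rboundary_diff rchains_diff)
  then show ?thesis unfolding rboundaries_def by blast
qed

lemma rboundaries_add:
  assumes "z \<in> rboundaries p X" "w \<in> rboundaries p X"
  shows "z + w \<in> rboundaries p X"
  using rboundaries_diff[OF assms(1) rboundaries_diff[OF rboundaries_zero assms(2)]] by simp

lemma rboundaries_sum:
  "(\<And>i. i \<in> I \<Longrightarrow> z i \<in> rboundaries p X) \<Longrightarrow> (\<Sum>i\<in>I. z i) \<in> rboundaries p X"
  by (induction I rule: infinite_finite_induct) (simp_all add: rboundaries_zero rboundaries_add)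

lemma rboundaries_scale:
  assumes "z \<in> rboundaries p X"
  shows "Poly_Mapping.map ((*) r) z \<in> rboundaries p X"
proof -
  obtain b where "z = rboundary (Suc p) b" "b \<in> rchains (Suc p) X"
    using assms unfolding rboundaries_def by blast
  then have "Poly_Mapping.map ((*) r) z = rboundary (Suc p) (Poly_Mapping.map ((*) r) b)"
    "Poly_Mapping.map ((*) r) b \<in> rchains (Suc p) X"
    by (simp_all add: rboundary_map[OF additive_on_mult_left UNIV_I] rchains_map)
  then show ?thesis unfolding rboundaries_def by blast
qed

lemma rcycles_zero: "0 \<in> rcycles p X"
  by (simp add: rcycles_def rchains_zero rboundary_zero)

lemma rcycles_diff: "z \<in> rcycles p X \<Longrightarrow> w \<in> rcycles p X \<Longrightarrow> z - w \<in> rcycles p X"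
  by (simp add: rcycles_def rchains_diff rboundary_diff)

lemma rcycles_add:
  assumes "z \<in> rcycles p X" "w \<in> rcycles p X"
  shows "z + w \<in> rcycles p X"
  using rcycles_diff[OF assms(1) rcycles_diff[OF rcycles_zero assms(2)]] by simp

lemma rcycles_scale:
  assumes "z \<in> rcycles p X"
  shows "Poly_Mapping.map ((*) r) z \<in> rcycles p X"
proof -
  have "rboundary p (Poly_Mapping.map ((*) r) z) = Poly_Mapping.map ((*) r) (rboundary p z)"
    by (rule rboundary_map[OF additive_on_mult_left UNIV_I])
  also have "\<dots> = 0"
    using assms by (intro poly_mapping_eqI) (simp add: rcycles_def lookup_map_zero)
  finally show ?thesis using assms by (simp add: rcycles_def rchains_map)
qed

lemma map_mult_diff:
  "Poly_Mapping.map ((*) r) (z - w) = Poly_Mapping.map ((*) r) z - Poly_Mapping.map ((*) (r::'k::ring_1)) w"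
  by (rule poly_mapping_eqI) (simp add: lookup_map_zero lookup_minus right_diff_distrib)

section \<open>The module operations in terms of representing cycles\<close>

lemma rclass_self: "z \<in> rclass p X z"
  by (simp add: rclass_def rboundaries_zero)

lemma rclass_eq_iff: "rclass p X z = rclass p X w \<longleftrightarrow> z - w \<in> rboundaries p X"
proof
  assume "rclass p X z = rclass p X w"
  with rclass_self[of z p X] have "z \<in> rclass p X w" by simp
  then show "z - w \<in> rboundaries p X" by (simp add: rclass_def)
next
  assume zw: "z - w \<in> rboundaries p X"
  have "x - z \<in> rboundaries p X \<longleftrightarrow> x - w \<in> rboundaries p X" for x
    using rboundaries_add[OF _ zw, of "x - z"] rboundaries_diff[OF _ zw, of "x - w"] by auto
  then show "rclass p X z = rclass p X w" by (simp add: rclass_def)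
qed

text \<open>The union in the definition of the sum collapses, because all pairs of representatives
  yield the same class.\<close>

lemma rhomology_add:
  "rclass p X z \<oplus>\<^bsub>rhomology p X\<^esub> rclass p X w = rclass p X (z + w)"
proof -
  have eq: "rclass p X (a + b) = rclass p X (z + w)" if "a \<in> rclass p X z" "b \<in> rclass p X w" for a b
  proof -
    have "(a - z) + (b - w) \<in> rboundaries p X"
      using that by (intro rboundaries_add) (simp_all add: rclass_def)
    then show ?thesis by (simp add: rclass_eq_iff algebra_simps)
  qed
  have "rclass p X z \<oplus>\<^bsub>rhomology p X\<^esub> rclass p X w =
      (\<Union>a\<in>rclass p X z. \<Union>b\<in>rclass p X w. rclass p X (a + b))"
    by (simp add: rhomology_def)
  also have "\<dots> = (\<Union>a\<in>rclass p X z. \<Union>b\<in>rclass p X w. rclass p X (z + w))"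
    by (intro SUP_cong refl eq)
  also have "\<dots> = rclass p X (z + w)" using rclass_self[of z p X] rclass_self[of w p X] by blast
  finally show ?thesis .
qed

lemma rhomology_smult:
  "r \<odot>\<^bsub>rhomology p X\<^esub> rclass p X z = rclass p X (Poly_Mapping.map ((*) r) z)"
proof -
  have eq: "rclass p X (Poly_Mapping.map ((*) r) a) = rclass p X (Poly_Mapping.map ((*) r) z)"
    if "a \<in> rclass p X z" for a
    using rboundaries_scale[of "a - z" p X r] that
    by (simp add: rclass_eq_iff map_mult_diff) (simp add: rclass_def)
  have "r \<odot>\<^bsub>rhomology p X\<^esub> rclass p X z =
      (\<Union>a\<in>rclass p X z. rclass p X (Poly_Mapping.map ((*) r) a))"
    by (simp add: rhomology_def)
  also have "\<dots> = (\<Union>a\<in>rclass p X z. rclass p X (Poly_Mapping.map ((*) r) z))"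
    by (intro SUP_cong refl eq)
  also have "\<dots> = rclass p X (Poly_Mapping.map ((*) r) z)" using rclass_self[of z p X] by blast
  finally show ?thesis .
qed

lemma rhomology_carrier: "carrier (rhomology p X) = rclass p X ` rcycles p X"
  by (simp add: rhomology_def)

lemma rhomology_zero: "\<zero>\<^bsub>rhomology p X\<^esub> = rclass p X 0"
  by (simp add: rhomology_def)

lemma abelian_monoid_rhomology: "abelian_monoid (rhomology p X)"
  by (rule abelian_monoidI)
    (auto simp: rhomology_carrier rhomology_zero rhomology_add add_ac rcycles_zero
      intro: rcycles_add)

text \<open>Turns a relation between classes into the statement that one explicit chain is a
  boundary.\<close>

lemma rhomology_finsum:
  fixes v :: "'i \<Rightarrow> ('a, 'k::ring_1) rchain set"
  assumes "finite I" "\<And>i. i \<in> I \<Longrightarrow> z i \<in> rcycles p X" "\<And>i. i \<in> I \<Longrightarrow> v i = rclass p X (z i)"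
  shows "(\<Oplus>\<^bsub>rhomology p X\<^esub>i\<in>I. c i \<odot>\<^bsub>rhomology p X\<^esub> v i) =
    rclass p X (\<Sum>i\<in>I. Poly_Mapping.map ((*) (c i)) (z i))"
  using assms
proof (induction I rule: finite_induct)
  interpret abelian_monoid "rhomology p X :: ('k, ('a, 'k) rchain set) module"
    by (rule abelian_monoid_rhomology)
  case empty
  show ?case by (simp add: rhomology_zero)
next
  interpret abelian_monoid "rhomology p X :: ('k, ('a, 'k) rchain set) module"
    by (rule abelian_monoid_rhomology)
  case (insert j I)
  have "c i \<odot>\<^bsub>rhomology p X\<^esub> v i \<in> carrier (rhomology p X)" if "i \<in> insert j I" for i
    using insert.prems that by (simp add: rhomology_smult rhomology_carrier rcycles_scale)
  then have "(\<Oplus>\<^bsub>rhomology p X\<^esub>i\<in>insert j I. c i \<odot>\<^bsub>rhomology p X\<^esub> v i) =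
      c j \<odot>\<^bsub>rhomology p X\<^esub> v j \<oplus>\<^bsub>rhomology p X\<^esub>
      (\<Oplus>\<^bsub>rhomology p X\<^esub>i\<in>I. c i \<odot>\<^bsub>rhomology p X\<^esub> v i)"
    using insert.hyps by (intro finsum_insert) auto
  then show ?case
    using insert by (simp add: rhomology_smult rhomology_add)
qed

text \<open>A relation over \<open>J\<close> extends to \<open>I\<close> by zero
  coefficients.\<close>

lemma linearly_independent_rhomology_subset:
  fixes v :: "'i \<Rightarrow> ('a, 'k::ring_1) rchain set"
  assumes indep: "linearly_independent (rhomology p X) I v" and "finite I" "J \<subseteq> I"
    and v: "\<And>i. i \<in> I \<Longrightarrow> v i \<in> carrier (rhomology p X)"
  shows "linearly_independent (rhomology p X) J v"
  unfolding linearly_independent_def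
proof (intro allI impI)
  fix c :: "'i \<Rightarrow> 'k"
  assume c: "(\<Oplus>\<^bsub>rhomology p X\<^esub>i\<in>J. c i \<odot>\<^bsub>rhomology p X\<^esub> v i) = \<zero>\<^bsub>rhomology p X\<^esub>"
  define c' where "c' i = (if i \<in> J then c i else 0)" for i
  have "\<forall>i\<in>I. \<exists>z. z \<in> rcycles p X \<and> v i = rclass p X z"
    using v by (auto simp: rhomology_carrier)
  then obtain z where z: "\<And>i. i \<in> I \<Longrightarrow> z i \<in> rcycles p X" "\<And>i. i \<in> I \<Longrightarrow> v i = rclass p X (z i)"
    by metis
  have "Poly_Mapping.map ((*) 0) (z i) = 0" for i
    by (rule poly_mapping_eqI) (simp add: lookup_map_zero)
  then have "(\<Sum>i\<in>I. Poly_Mapping.map ((*) (c' i)) (z i)) = (\<Sum>i\<in>J. Poly_Mapping.map ((*) (c i)) (z i))"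
    using \<open>finite I\<close> \<open>J \<subseteq> I\<close> by (intro sum.mono_neutral_cong_right) (auto simp: c'_def)
  then have "(\<Oplus>\<^bsub>rhomology p X\<^esub>i\<in>I. c' i \<odot>\<^bsub>rhomology p X\<^esub> v i) = \<zero>\<^bsub>rhomology p X\<^esub>"
    using c rhomology_finsum[OF \<open>finite I\<close> z] 
      rhomology_finsum[OF finite_subset[OF \<open>J \<subseteq> I\<close> \<open>finite I\<close>], of z p X v c] z \<open>J \<subseteq> I\<close>
    by (simp add: subset_iff)
  then have "\<forall>i\<in>I. c' i = 0" using indep unfolding linearly_independent_def by blast
  then show "\<forall>i\<in>J. c i = 0" using \<open>J \<subseteq> I\<close> by (metis c'_def subsetD)
qed

section \<open>Closed curves as 1-cycles\<close>

lemma singular_simplex_curve_simplex: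
  assumes "pathin X c"
  shows "singular_simplex 1 X (curve_simplex c)"
proof -
  let ?T = "subtopology (powertop_real UNIV) (standard_simplex 1)"
  have "continuous_map ?T euclideanreal (\<lambda>x. x 1)"
    by (intro continuous_map_from_subtopology continuous_map_product_projection) simp
  then have "continuous_map ?T (top_of_set {0..1}) (\<lambda>x. x 1)"
    by (auto simp: continuous_map_in_subtopology standard_simplex_def)
  then have "continuous_map ?T X (c \<circ> (\<lambda>x. x 1))"
    using assms continuous_map_compose unfolding pathin_def by blast
  then have "continuous_map ?T X (curve_simplex c)"
    by (rule continuous_map_eq) (auto simp: curve_simplex_def)
  then show ?thesis
    by (simp add: singular_simplex_def curve_simplex_def)
qed

text \<open>Both faces are the constant 0-simplex at the base point, and they enter with opposite
  signs.\<close>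

lemma closed_curve_rcycle:
  assumes "closed_curve X c"
  shows "Poly_Mapping.single (curve_simplex c) (1::'k::ring_1) \<in> rcycles 1 X"
proof -
  have face: "singular_face 1 k (curve_simplex c) = restrict (\<lambda>_. c 0) (standard_simplex 0)"
    if "k \<le> 1" for k
  proof (rule ext)
    fix x
    have "c (simplical_face k x 1) = c 0" if "x \<in> standard_simplex 0"
      using that \<open>k \<le> 1\<close> assms
      by (cases "k = 0") (auto simp: standard_simplex_def simplical_face_def closed_curve_def)
    then show "singular_face 1 k (curve_simplex c) x = restrict (\<lambda>_. c 0) (standard_simplex 0) x"
      using simplical_face_in_standard_simplex[of 1 k x] \<open>k \<le> 1\<close>
      by (auto simp: singular_face_def curve_simplex_def)
  qed
  have "rboundary 1 (Poly_Mapping.single (curve_simplex c) (1::'k)) = 0"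
    using face[of 0] face[of 1] by (simp add: rboundary_def flip: single_add)
  then show ?thesis
    using assms singular_simplex_curve_simplex by (auto simp: rcycles_def rchains_def closed_curve_def)
qed

text \<open>Takes the place of a rank comparison, which fails for arbitrary classes over a ring like
  the endomorphisms of an infinite-dimensional vector space. Classes of curves have representing
  cycles with the single coefficient 1, which the retraction sends to an integer.\<close>

lemma curve_classes_dependent:
  fixes s :: "'i \<Rightarrow> real \<Rightarrow> 'a" and t :: "'j \<Rightarrow> real \<Rightarrow> 'a"
    and X :: "'a topology"
  defines "M \<equiv> rhomology 1 X :: ('k::ring_1, ('a, 'k) rchain set) module"
  assumes fin: "finite I" "finite J" and card: "card J < card I"
    and s: "\<And>i. i \<in> I \<Longrightarrow> closed_curve X (s i)" and t: "\<And>j. j \<in> J \<Longrightarrow> closed_curve X (t j)"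
    and comb: "\<And>i. i \<in> I \<Longrightarrow>
      linear_combination_of M J (\<lambda>j. curve_class X (t j)) (curve_class X (s i))"
  shows "\<not> linearly_independent M I (\<lambda>i. curve_class X (s i))"
proof
  assume indep: "linearly_independent M I (\<lambda>i. curve_class X (s i))"
  define \<sigma> where "\<sigma> i = curve_simplex (s i)" for i
  define \<tau> where "\<tau> j = curve_simplex (t j)" for j
  \<comment> \<open>The relation "\<open>x\<close> times the \<open>i\<close>-th curve equals the
    combination of the \<open>t j\<close> with coefficients \<open>y j\<close>", written as a chain
    that has to bound.\<close>
  define rel :: "'i \<Rightarrow> 'k \<Rightarrow> ('j \<Rightarrow> 'k) \<Rightarrow> ('a, 'k) rchain" where
    "rel i x y = Poly_Mapping.single (\<sigma> i) x - (\<Sum>j\<in>J. Poly_Mapping.single (\<tau> j) (y j))" for i x y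
  have "\<exists>c b. b \<in> rchains 2 X \<and> rel i 1 c = rboundary 2 b" if i: "i \<in> I" for i
  proof -
    obtain c :: "'j \<Rightarrow> 'k" where
      "curve_class X (s i) = (\<Oplus>\<^bsub>M\<^esub>j\<in>J. c j \<odot>\<^bsub>M\<^esub> curve_class X (t j))"
      using comb[OF i] unfolding linear_combination_of_def by blast
    also have "\<dots> = rclass 1 X (\<Sum>j\<in>J. Poly_Mapping.map ((*) (c j)) (Poly_Mapping.single (\<tau> j) 1))"
      unfolding M_def by (rule rhomology_finsum)
        (simp_all add: fin t curve_class_def \<tau>_def closed_curve_rcycle del: One_nat_def)
    finally have "rel i 1 c \<in> rboundaries 1 X"
      by (simp add: curve_class_def rclass_eq_iff rel_def \<sigma>_def map_single_zero)
    then show ?thesis by (auto simp: rboundaries_def numeral_2_eq_2)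
  qed
  then obtain c b where b: "\<And>i. i \<in> I \<Longrightarrow> b i \<in> rchains 2 X"
    "\<And>i. i \<in> I \<Longrightarrow> rel i 1 (c i) = rboundary 2 (b i)"
    by metis
  \<comment> \<open>All coefficients in the relations and in their bounding chains; there are
    finitely many, so one \<open>f\<close> is additive on all of them.\<close>
  define F where "F = (\<Union>i\<in>I. c i ` J \<union> Poly_Mapping.lookup (b i) ` Poly_Mapping.keys (b i))"
  have "finite F" using fin by (simp add: F_def)
  then obtain A and f :: "'k \<Rightarrow> 'k" and N where
    A: "F \<subseteq> A" "1 \<in> A" and f: "additive_on A f" "range f \<subseteq> \<int>" and N: "f 1 = of_int N"
    "\<And>m. (of_int (N * m) :: 'k) = 0 \<Longrightarrow> (of_int m :: 'k) = 0"
    using integral_retraction[of F] by metis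
  have A0: "0 \<in> A" using f by (simp add: additive_on_def)
  have f0: "f 0 = 0" by (rule additive_on_zero[OF f(1)])
  have "\<exists>m::int. f (c i j) = of_int m" for i j
    using f(2) by (metis Ints_cases rangeI subsetD)
  then obtain m :: "'i \<Rightarrow> 'j \<Rightarrow> int" where m: "\<And>i j. f (c i j) = of_int (m i j)"
    by metis
  \<comment> \<open>Applying \<open>f\<close> to every coefficient of
    \<open>rel i 1 (c i) = rboundary 2 (b i)\<close> gives a relation with integer
    coefficients.\<close>
  have rel_int: "rel i (of_int N) (\<lambda>j. of_int (m i j)) \<in> rboundaries 1 X" if i: "i \<in> I" for i
  proof -
    have cA: "(c i j when P) \<in> A" if "j \<in> J" for j P
      using A(1) A0 i that by (auto simp: F_def when_def)
    have f_when: "f (x when P) = (f x when P)" for x P using f0 by (simp add: when_def)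
    have "rel i (f 1) (\<lambda>j. f (c i j)) = Poly_Mapping.map f (rel i 1 (c i))"
    proof (rule poly_mapping_eqI)
      fix w
      have "(1 when \<sigma> i = w) \<in> A" using A(2) A0 by (simp add: when_def)
      note diff = additive_on_diff(2)[OF f(1) this
          additive_on_sum(1)[OF f(1), of J "\<lambda>j. c i j when \<tau> j = w"]]
      show "Poly_Mapping.lookup (rel i (f 1) (\<lambda>j. f (c i j))) w =
          Poly_Mapping.lookup (Poly_Mapping.map f (rel i 1 (c i))) w"
        using additive_on_sum(2)[OF f(1), of J "\<lambda>j. c i j when \<tau> j = w"] cA diff
        by (simp add: rel_def lookup_map_zero[where f = f] f0 lookup_minus lookup_sum lookup_single f_when)
    qed
    also have "\<dots> = rboundary 2 (Poly_Mapping.map f (b i))"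
      unfolding b(2)[OF i]
    proof (rule rboundary_map[OF f(1), symmetric])
      show "Poly_Mapping.lookup (b i) w \<in> A" for w
      proof (cases "w \<in> Poly_Mapping.keys (b i)")
        case True
        then show ?thesis using A(1) i unfolding F_def by blast
      next
        case False
        then show ?thesis using A0 by (simp add: in_keys_iff)
      qed
    qed
    finally show ?thesis
      using rchains_map[where f = f, OF f0 b(1)[OF i]]
      by (auto simp: N(1) m rboundaries_def numeral_2_eq_2)
  qed
  obtain a where a: "Gcd (a ` I) = 1" "\<And>j. j \<in> J \<Longrightarrow> (\<Sum>i\<in>I. a i * m i j) = 0"
    using int_left_kernel_primitive[OF fin(2,1) card, of m] by blast
  define e :: "'i \<Rightarrow> 'k" where "e i = of_int (a i * N)" for i
  \<comment> \<open>In the sum of the integral relations weighted by \<open>a i\<close>, each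
    \<open>\<tau> j\<close> gets the coefficient \<open>\<Sum>i\<in>I. a i * m i j = 0\<close>; only
    the curves \<open>s i\<close> remain, with coefficients \<open>e i\<close>.\<close>
  have "(\<Sum>i\<in>I. Poly_Mapping.map ((*) (of_int (a i))) (rel i (of_int N) (\<lambda>j. of_int (m i j)))) =
    (\<Sum>i\<in>I. rel i (e i) (\<lambda>j. of_int (a i * m i j)))"
    by (intro sum.cong refl poly_mapping_eqI)
      (simp add: rel_def e_def lookup_map_zero lookup_minus lookup_sum lookup_single
        right_diff_distrib sum_distrib_left mult_when)
  also have "\<dots> = (\<Sum>i\<in>I. Poly_Mapping.single (\<sigma> i) (e i)) -
      (\<Sum>j\<in>J. Poly_Mapping.single (\<tau> j) (of_int (\<Sum>i\<in>I. a i * m i j)))"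
    by (simp add: rel_def sum_subtractf single_sum of_int_sum sum.swap[of _ I J])
  also have "\<dots> = (\<Sum>i\<in>I. Poly_Mapping.map ((*) (e i)) (Poly_Mapping.single (\<sigma> i) 1))"
    using a(2) by (simp add: map_single_zero del: of_int_sum of_int_mult)
  finally have "(\<Sum>i\<in>I. Poly_Mapping.map ((*) (e i)) (Poly_Mapping.single (\<sigma> i) 1)) \<in> rboundaries 1 X"
    using rboundaries_sum[OF rboundaries_scale[OF rel_int], of I "\<lambda>i. i" "\<lambda>i. of_int (a i)"] by simp
  then have "(\<Oplus>\<^bsub>M\<^esub>i\<in>I. e i \<odot>\<^bsub>M\<^esub> curve_class X (s i)) = \<zero>\<^bsub>M\<^esub>"
    unfolding M_def
    by (subst rhomology_finsum[where z = "\<lambda>i. Poly_Mapping.single (\<sigma> i) 1"])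
      (simp_all add: fin s curve_class_def \<sigma>_def rhomology_zero rclass_eq_iff closed_curve_rcycle
        del: One_nat_def)
  then have "\<forall>i\<in>I. e i = 0" using indep unfolding linearly_independent_def by blast
  then have "int CHAR('k) dvd a i" if "i \<in> I" for i
    using N(2)[of "a i"] that by (simp add: e_def mult.commute flip: of_int_eq_0_iff_char_dvd)
  then have "int CHAR('k) dvd Gcd (a ` I)" by (intro Gcd_greatest) auto
  then have "(of_int 1 :: 'k) = 0" unfolding a(1) by (subst of_int_eq_0_iff_char_dvd)
  then show False by simp
qed

section \<open>Comparison of the successive minima with an independent family\<close>

theorem lemma4p3:
  fixes S :: "'a set" and d :: "'a \<Rightarrow> 'a \<Rightarrow> real" and g :: nat
    and \<alpha> :: "nat \<Rightarrow> real \<Rightarrow> 'a"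
    and \<gamma> \<delta> :: "nat \<Rightarrow> ('a, 'k::ring_1) rchain set"
  defines "X \<equiv> Metric_space.mtopology S d"
  assumes "g \<ge> 2"
    and "length_metric S d"
    and "closed_orientable_surface g X"
    and "has_minimal_closed_curves X d"
    and "successive_minima_I TYPE('k) X d (2 * g) \<alpha>"
    and "\<And>j. j \<in> {1..2 * g} \<Longrightarrow> \<gamma> j = curve_class X (\<alpha> j)"
    and "\<And>i. i \<in> {1..2 * g} \<Longrightarrow> \<delta> i \<in> carrier (rhomology 1 X)"
    and "linearly_independent (rhomology 1 X) {1..2 * g} \<delta>"
    and "\<And>i j. 1 \<le> i \<Longrightarrow> i \<le> j \<Longrightarrow> j \<le> 2 * g \<Longrightarrow> class_length X d (\<delta> i) \<le> class_length X d (\<delta> j)"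
    and "k \<in> {1..2 * g}"
  shows "class_length X d (\<gamma> k) \<le> class_length X d (\<delta> k)"
proof (rule ccontr)
  assume "\<not> ?thesis"
  then have less: "class_length X d (\<delta> k) < class_length X d (\<gamma> k)" by simp
  let ?M = "rhomology 1 X :: ('k, ('a, 'k) rchain set) module"
  interpret M: abelian_monoid ?M by (rule abelian_monoid_rhomology)
  \<comment> \<open>For \<open>j = 1\<close> the index set \<open>{1..0}\<close> is empty and the
    empty sum is zero, so the first step of the procedure obeys the same rule as the later
    ones.\<close>
  have shortest: "shortest_closed_curve X d (\<lambda>c. \<not> linear_combination_of ?M {1..j - 1}
      (\<lambda>i. curve_class X (\<alpha> i)) (curve_class X c)) (\<alpha> j)" if j: "j \<in> {1..2 * g}" for j
    using assms(6) j unfolding successive_minima_I_def Let_def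
    by (cases "j = 1") (simp_all add: linear_combination_of_def del: One_nat_def)
  then have closed: "closed_curve X (\<alpha> j)" if "j \<in> {1..2 * g}" for j
    using that unfolding shortest_closed_curve_def by blast
  have "\<exists>c. closed_curve X c \<and> curve_class X c = \<delta> i \<and>
      linear_combination_of ?M {1..k - 1} (\<lambda>i. curve_class X (\<alpha> i)) (curve_class X c)"
    if i: "i \<in> {1..k}" for i
  proof -
    have "class_length X d (\<gamma> k) \<le> curve_length d (\<alpha> k)"
      unfolding class_length_def
      using closed[OF assms(11)] assms(7)[OF assms(11)] by (intro INF_lower) simp
    moreover have "class_length X d (\<delta> i) \<le> class_length X d (\<delta> k)"
      using assms(10)[of i k] assms(11) i by simp
    \<comment> \<open>Strictness of this inequality yields an actual curve in the class
      \<open>\<delta> i\<close> shorter than \<open>\<alpha> k\<close>, whether or not the infimum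
      is attained. By minimality of \<open>\<alpha> k\<close>, that curve violates the search
      condition.\<close>
    ultimately have "class_length X d (\<delta> i) < curve_length d (\<alpha> k)"
      using less by (meson le_less_trans less_le_trans)
    then obtain c where c: "closed_curve X c" "curve_class X c = \<delta> i" "curve_length d c < curve_length d (\<alpha> k)"
      unfolding class_length_def INF_less_iff by blast
    then show ?thesis
      using shortest[OF assms(11)] unfolding shortest_closed_curve_def by (metis leD)
  qed
  then obtain s where s: "\<And>i. i \<in> {1..k} \<Longrightarrow> closed_curve X (s i)"
    "\<And>i. i \<in> {1..k} \<Longrightarrow> curve_class X (s i) = \<delta> i"
    "\<And>i. i \<in> {1..k} \<Longrightarrow> linear_combination_of ?M {1..k - 1} (\<lambda>i. curve_class X (\<alpha> i)) (curve_class X (s i))"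
    by metis
  have "linearly_independent ?M {1..k} \<delta>"
    using linearly_independent_rhomology_subset[OF assms(9)] assms(8,11) by simp
  then have "linearly_independent ?M {1..k} (\<lambda>i. curve_class X (s i))"
  proof -
    have "(\<Oplus>\<^bsub>?M\<^esub>i\<in>{1..k}. c i \<odot>\<^bsub>?M\<^esub> curve_class X (s i)) =
        (\<Oplus>\<^bsub>?M\<^esub>i\<in>{1..k}. c i \<odot>\<^bsub>?M\<^esub> \<delta> i)" for c
    proof (rule M.finsum_cong')
      show "(\<lambda>i. c i \<odot>\<^bsub>?M\<^esub> \<delta> i) \<in> {1..k} \<rightarrow> carrier ?M"
        using assms(8,11) by (fastforce simp: rhomology_carrier rhomology_smult intro: rcycles_scale)
    qed (use s(2) in auto)
    then show ?thesis
      using \<open>linearly_independent ?M {1..k} \<delta>\<close> by (simp add: linearly_independent_def)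
  qed
  \<comment> \<open>The \<open>k\<close> curves \<open>s i\<close> have classes that are
    combinations of only \<open>k - 1\<close> classes, where \<open>k \<ge> 1\<close>.\<close>
  moreover have "\<not> linearly_independent ?M {1..k} (\<lambda>i. curve_class X (s i))"
    by (rule curve_classes_dependent[where J = "{1..k - 1}" and t = \<alpha>])
      (use s closed assms(11) in auto)
  ultimately show False by blast
qed

end
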